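(* Let $G=(V,E)$ be a connected graph on $n\ge 1$ vertices, let $\omega$ be a proper colouring of $G$, and let $s$ be a positive integer. Suppose that, for every set $A\subset V$ such that $G[A]$ is connected, we have $|N(A)|\le s$. Then $$m(G,\omega)\ \ge\ \frac{1}{s}(n-1).$$
   Context: All graphs are finite and simple. $G[A]$ is the subgraph induced by $A$, and $N(A)$ is the set of vertices of $V\setminus A$ having at least one neighbour in $A$. The (free) Flood-It game: let $G=(V,E)$ be a graph with a colouring $\omega:V\to C$, where $C$ is a finite colour-set. A monochromatic component is a maximal set of vertices of one colour inducing a connected subgraph. A move $(v,d)$, with $v\in V$ and $d\in C$, recolours with colour $d$ every vertex in the monochromatic component (with respect to the current colouring) containing $v$. For $d\in C$, $m(G,\omega,d)$ is the minimum number of moves needed, starting from $\omega$, to give all vertices of $G$ colour $d$, and $m(G,\omega)=\min_{d\in C}m(G,\omega,d)$. *)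

theory Defs
  imports Complex_Main "Graph_Theory.Digraph_Component"
begin

text \<open>
  Finite simple graphs are the symmetric, loop-free digraphs without parallel arcs of the locale
  \<^locale>\<open>graph\<close>; \<open>G \<restriction> A\<close> is the induced subgraph \<open>G[A]\<close>. The null graph is not connected in the
  sense of \<^const>\<open>Digraph_Component.connected\<close>.
\<close>

definition neighbourhood :: "('a, 'b) pre_digraph \<Rightarrow> 'a set \<Rightarrow> 'a set" where
  "neighbourhood G A = {v \<in> verts G - A. \<exists>u \<in> A. u \<rightarrow>\<^bsub>G\<^esub> v}"

definition proper_colouring :: "('a, 'b) pre_digraph \<Rightarrow> ('a \<Rightarrow> 'c) \<Rightarrow> bool" where
  "proper_colouring G \<omega> \<longleftrightarrow> (\<forall>u \<in> verts G. \<forall>v \<in> verts G. u \<rightarrow>\<^bsub>G\<^esub> v \<longrightarrow> \<omega> u \<noteq> \<omega> v)"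

definition mono_connected :: "('a, 'b) pre_digraph \<Rightarrow> ('a \<Rightarrow> 'c) \<Rightarrow> 'a set \<Rightarrow> bool" where
  "mono_connected G \<omega> A \<longleftrightarrow>
     A \<subseteq> verts G \<and> (\<exists>c. \<forall>x \<in> A. \<omega> x = c) \<and> Digraph_Component.connected (G \<restriction> A)"

definition mono_component :: "('a, 'b) pre_digraph \<Rightarrow> ('a \<Rightarrow> 'c) \<Rightarrow> 'a set \<Rightarrow> bool" where
  "mono_component G \<omega> A \<longleftrightarrow>
     mono_connected G \<omega> A \<and> \<not> (\<exists>B. A \<subset> B \<and> mono_connected G \<omega> B)"

definition flood_move :: "('a, 'b) pre_digraph \<Rightarrow> ('a \<Rightarrow> 'c) \<Rightarrow> 'a \<times> 'c \<Rightarrow> ('a \<Rightarrow> 'c)" where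
  "flood_move G \<omega> = (\<lambda>(v, d) u.
     if \<exists>A. mono_component G \<omega> A \<and> v \<in> A \<and> u \<in> A then d else \<omega> u)"

definition floods_to ::
  "('a, 'b) pre_digraph \<Rightarrow> 'c set \<Rightarrow> ('a \<Rightarrow> 'c) \<Rightarrow> 'c \<Rightarrow> ('a \<times> 'c) list \<Rightarrow> bool" where
  "floods_to G C \<omega> d ms \<longleftrightarrow>
     set ms \<subseteq> verts G \<times> C \<and> (\<forall>u \<in> verts G. foldl (flood_move G) \<omega> ms u = d)"

definition min_moves_to :: "('a, 'b) pre_digraph \<Rightarrow> 'c set \<Rightarrow> ('a \<Rightarrow> 'c) \<Rightarrow> 'c \<Rightarrow> nat" where
  "min_moves_to G C \<omega> d = (LEAST k. \<exists>ms. floods_to G C \<omega> d ms \<and> length ms = k)"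

definition min_moves :: "('a, 'b) pre_digraph \<Rightarrow> 'c set \<Rightarrow> ('a \<Rightarrow> 'c) \<Rightarrow> nat" where
  "min_moves G C \<omega> = Min (min_moves_to G C \<omega> ` C)"

text \<open>
  Every colour of \<open>C\<close> can be reached (playing \<open>d\<close> once at every vertex), so the \<open>LEAST\<close> in
  \<^const>\<open>min_moves_to\<close> is attained.
\<close>

lemma mono_component_exists:
  assumes "graph G" "v \<in> verts G"
  obtains A where "mono_component G \<omega> A" "v \<in> A"
proof -
  interpret graph G by fact
  let ?S = "{A. mono_connected G \<omega> A \<and> v \<in> A}"
  have fin: "finite ?S"
    by (rule finite_subset[of _ "Pow (verts G)"]) (auto simp: mono_connected_def)
  have "{v} \<in> ?S"
    using assms(2) by (auto simp: mono_connected_def connected_conv)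
  with finite_has_maximal[OF fin] obtain A where
    A: "A \<in> ?S" "\<forall>B \<in> ?S. A \<subseteq> B \<longrightarrow> A = B" by blast
  have "mono_component G \<omega> A"
    using A unfolding mono_component_def by blast
  with A show thesis by (auto intro: that)
qed

lemma flood_move_eq:
  assumes "(\<exists>A. mono_component G \<omega> A \<and> v \<in> A \<and> u \<in> A) \<or> \<omega> u = d"
  shows "flood_move G \<omega> (v, d) u = d"
  using assms by (auto simp: flood_move_def)

lemma floods_to_exists:
  assumes "graph G" "d \<in> C"
  shows "\<exists>ms. floods_to G C \<omega> d ms"
proof -
  interpret graph G by fact
  have "\<exists>ms. set ms \<subseteq> verts G \<times> C \<and> (\<forall>u \<in> S. foldl (flood_move G) \<omega> ms u = d)"
    if "finite S" "S \<subseteq> verts G" for S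
    using that
  proof (induction S rule: finite_induct)
    case empty
    show ?case by (rule exI[of _ "[]"]) simp
  next
    case (insert v S)
    then obtain ms where ms: "set ms \<subseteq> verts G \<times> C" "\<forall>u \<in> S. foldl (flood_move G) \<omega> ms u = d"
      by auto
    obtain A where A: "mono_component G (foldl (flood_move G) \<omega> ms) A" "v \<in> A"
      using mono_component_exists[OF assms(1)] insert.prems by blast
    show ?case
    proof (intro exI[of _ "ms @ [(v, d)]"] conjI ballI)
      show "set (ms @ [(v, d)]) \<subseteq> verts G \<times> C"
        using ms(1) insert.prems assms(2) by simp
      show "foldl (flood_move G) \<omega> (ms @ [(v, d)]) u = d" if "u \<in> insert v S" for u
      proof -
        have "flood_move G (foldl (flood_move G) \<omega> ms) (v, d) u = d"
          by (rule flood_move_eq) (use that ms(2) A in blast)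
        then show ?thesis by simp
      qed
    qed
  qed
  from this[of "verts G"] show ?thesis by (auto simp: floods_to_def)
qed

lemma min_moves_to_attained:
  assumes "graph G" "d \<in> C"
  shows "\<exists>ms. floods_to G C \<omega> d ms \<and> length ms = min_moves_to G C \<omega> d"
proof -
  have "\<exists>k ms. floods_to G C \<omega> d ms \<and> length ms = k"
    using floods_to_exists[OF assms] by blast
  then show ?thesis unfolding min_moves_to_def by (rule LeastI_ex)
qed

end

theory Submission
  imports Defs
begin

text \<open>
  A move on a monochromatic component \<open>A\<close> can only merge \<open>A\<close> with components that meet \<open>N(A)\<close>, and
  distinct components meet it in distinct vertices; so the number of components drops by at most
  \<open>s\<close> per move. It is \<open>n\<close> for a proper colouring and \<open>1\<close> at the end. Instead of counting components,
  we maintain a set \<open>S\<close> of discarded vertices such that every component has at most one vertex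
  outside \<open>S\<close>; each move enlarges \<open>S\<close> by at most \<open>s\<close>.
\<close>

text \<open>On vertices, the classes of \<open>(mono_arcs G \<omega>)\<^sup>*\<close> are the
  monochromatic components; maximality is then built in.\<close>

definition mono_arcs :: "('a, 'b) pre_digraph \<Rightarrow> ('a \<Rightarrow> 'c) \<Rightarrow> 'a rel" where
  "mono_arcs G \<omega> = {(u, v). u \<rightarrow>\<^bsub>G\<^esub> v \<and> \<omega> u = \<omega> v}"

text \<open>Finiteness is demanded because \<open>card\<close> of an infinite set is 0, which would
  make bounds on \<open>card S\<close> void.\<close>

definition discarding :: "('a, 'b) pre_digraph \<Rightarrow> ('a \<Rightarrow> 'c) \<Rightarrow> 'a set \<Rightarrow> bool" where
  "discarding G \<omega> S \<longleftrightarrow>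
     finite S \<and> (\<forall>(x, y) \<in> (mono_arcs G \<omega>)\<^sup>*. x \<notin> S \<longrightarrow> y \<notin> S \<longrightarrow> x = y)"

context graph
begin

text \<open>Arcs of a \<open>graph\<close> are symmetric, so the symmetric closure in the general
  notion of connectedness changes nothing and plain reachability inside \<open>A\<close>
  remains.\<close>

lemma connected_induce_iff:
  "Digraph_Component.connected (G \<restriction> A) \<longleftrightarrow>
     A \<noteq> {} \<and> (\<forall>u \<in> A. \<forall>v \<in> A. (u, v) \<in> (arcs_ends G \<inter> A \<times> A)\<^sup>*)"
proof -
  have "arcs_ends (G \<restriction> A) = arcs_ends G \<inter> A \<times> A"
    by (auto simp: arcs_ends_conv)
  moreover have "(arcs_ends G \<inter> A \<times> A)\<^sup>s = arcs_ends G \<inter> A \<times> A"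
    using graph_symmetric by (auto simp: symcl_def)
  moreover have "(u, v) \<in> rtrancl_on A (arcs_ends G \<inter> A \<times> A) \<longleftrightarrow>
      (u, v) \<in> (arcs_ends G \<inter> A \<times> A)\<^sup>*" if "u \<in> A" for u v
  proof
    show "(u, v) \<in> (arcs_ends G \<inter> A \<times> A)\<^sup>*" if "(u, v) \<in> rtrancl_on A (arcs_ends G \<inter> A \<times> A)"
      using that by (rule rtrancl_on_rtranclI)
    show "(u, v) \<in> rtrancl_on A (arcs_ends G \<inter> A \<times> A)" if "(u, v) \<in> (arcs_ends G \<inter> A \<times> A)\<^sup>*"
      using that
      by (induction rule: rtrancl_induct) (use \<open>u \<in> A\<close> in \<open>auto intro: rtrancl_on_into_rtrancl_on\<close>)
  qed
  ultimately show ?thesis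
    by (simp add: connected_conv)
qed

lemma sym_rtrancl_mono_arcs: "sym ((mono_arcs G \<omega>)\<^sup>*)"
  by (intro sym_rtrancl symI) (auto simp: mono_arcs_def dest: graph_symmetric)

lemma mono_connected_imp_rtrancl:
  assumes "mono_connected G \<omega> A" "u \<in> A" "v \<in> A"
  shows "(u, v) \<in> (mono_arcs G \<omega>)\<^sup>*"
proof -
  have "(u, v) \<in> (arcs_ends G \<inter> A \<times> A)\<^sup>*"
    using assms by (auto simp: mono_connected_def connected_induce_iff)
  moreover have "arcs_ends G \<inter> A \<times> A \<subseteq> mono_arcs G \<omega>"
    using assms(1) by (auto simp: mono_connected_def mono_arcs_def)
  ultimately show ?thesis
    using rtrancl_mono by blast
qed

lemma mono_connected_Image:
  assumes "v \<in> verts G"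
  shows "mono_connected G \<omega> ((mono_arcs G \<omega>)\<^sup>* `` {v})" (is "mono_connected G \<omega> ?A")
proof -
  \<comment> \<open>Connectedness is wanted in the induced subgraph, so the induction also records
    that the path from \<open>v\<close> never leaves the class.\<close>
  have cls: "x \<in> verts G \<and> \<omega> x = \<omega> v \<and> (v, x) \<in> (arcs_ends G \<inter> ?A \<times> ?A)\<^sup>*"
    if "(v, x) \<in> (mono_arcs G \<omega>)\<^sup>*" for x
    using that
  proof (induction rule: rtrancl_induct)
    case base
    then show ?case using assms by simp
  next
    case (step y z)
    then have "y \<in> ?A" "z \<in> ?A" by (auto intro: rtrancl_into_rtrancl)
    moreover have "y \<rightarrow>\<^bsub>G\<^esub> z" "\<omega> y = \<omega> z" using step.hyps by (auto simp: mono_arcs_def)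
    ultimately show ?case
      using step.IH by (auto intro: rtrancl_into_rtrancl)
  qed
  have "sym ((arcs_ends G \<inter> ?A \<times> ?A)\<^sup>*)"
    by (intro sym_rtrancl symI) (auto dest: graph_symmetric)
  then have "(x, y) \<in> (arcs_ends G \<inter> ?A \<times> ?A)\<^sup>*" if "x \<in> ?A" "y \<in> ?A" for x y
    using cls[of x] cls[of y] that by (auto dest: symD intro: rtrancl_trans)
  moreover have "v \<in> ?A" by auto
  ultimately have "Digraph_Component.connected (G \<restriction> ?A)"
    unfolding connected_induce_iff by blast
  then show ?thesis
    using cls unfolding mono_connected_def by blast
qed

text \<open>The class of \<open>v\<close> is itself monochromatic and connected, and it contains
  \<open>A\<close>; maximality of \<open>A\<close> excludes a proper inclusion.\<close>

lemma mono_component_eq_Image: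
  assumes "mono_component G \<omega> A" "v \<in> A"
  shows "A = (mono_arcs G \<omega>)\<^sup>* `` {v}"
proof -
  have A: "mono_connected G \<omega> A" and v: "v \<in> verts G"
    using assms by (auto simp: mono_component_def mono_connected_def)
  have "A \<subseteq> (mono_arcs G \<omega>)\<^sup>* `` {v}"
    using mono_connected_imp_rtrancl[OF A assms(2)] by blast
  then show ?thesis
    using mono_connected_Image[OF v] assms(1) unfolding mono_component_def by blast
qed

lemma flood_move_eq_if:
  assumes "v \<in> verts G"
  shows "flood_move G \<omega> (v, d) u = (if (v, u) \<in> (mono_arcs G \<omega>)\<^sup>* then d else \<omega> u)"
proof -
  obtain A where "mono_component G \<omega> A" "v \<in> A"
    using mono_component_exists[OF graph_axioms assms] .
  then have "(\<exists>A. mono_component G \<omega> A \<and> v \<in> A \<and> u \<in> A) \<longleftrightarrow> (v, u) \<in> (mono_arcs G \<omega>)\<^sup>*"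
    using mono_component_eq_Image by blast
  then show ?thesis by (simp add: flood_move_def)
qed

text \<open>Only the class \<open>A\<close> of \<open>v\<close> can grow, by absorbing old classes
  that meet N(A). Discarding the survivors of those classes, collected in \<open>T\<close>, leaves
  at most the survivor of \<open>A\<close> in the merged class.\<close>

lemma flood_move_discarding:
  assumes nbh: "\<And>A. A \<subseteq> verts G \<Longrightarrow> Digraph_Component.connected (G \<restriction> A) \<Longrightarrow>
           card (neighbourhood G A) \<le> s"
    and v: "v \<in> verts G"
    and "discarding G \<omega> S"
  shows "\<exists>S'. discarding G (flood_move G \<omega> (v, d)) S' \<and> card S' \<le> card S + s"
proof -
  define R where "R = (mono_arcs G \<omega>)\<^sup>*"
  define R' where "R' = (mono_arcs G (flood_move G \<omega> (v, d)))\<^sup>*"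
  define A where "A = R `` {v}"
  define T where "T = {x. x \<notin> S \<and> (\<exists>w \<in> neighbourhood G A. (w, x) \<in> R)}"
  have finS: "finite S" and S: "\<And>x y. (x, y) \<in> R \<Longrightarrow> x \<notin> S \<Longrightarrow> y \<notin> S \<Longrightarrow> x = y"
    using assms(3) unfolding discarding_def R_def by auto
  have symR: "(y, x) \<in> R" if "(x, y) \<in> R" for x y
    using that sym_rtrancl_mono_arcs unfolding R_def by (meson symD)
  have transR: "(x, z) \<in> R" if "(x, y) \<in> R" "(y, z) \<in> R" for x y z
    using that unfolding R_def by (rule rtrancl_trans)
  have "mono_connected G \<omega> A"
    unfolding A_def R_def using v by (rule mono_connected_Image)
  then have card_nbh: "card (neighbourhood G A) \<le> s"
    using nbh by (simp add: mono_connected_def)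
  have fin_nbh: "finite (neighbourhood G A)"
    by (simp add: neighbourhood_def)
  \<comment> \<open>Each old class has at most one survivor, so sending \<open>w\<close> to the
    survivor of its class covers \<open>T\<close>. The value is arbitrary when the class lies inside
    \<open>S\<close>, hence only an inclusion.\<close>
  have sub: "T \<subseteq> (\<lambda>w. THE x. x \<notin> S \<and> (w, x) \<in> R) ` neighbourhood G A"
  proof
    fix x assume "x \<in> T"
    then obtain w where w: "w \<in> neighbourhood G A" "(w, x) \<in> R" "x \<notin> S"
      by (auto simp: T_def)
    have "(THE x. x \<notin> S \<and> (w, x) \<in> R) = x"
      using w(2,3) S symR transR by (intro the_equality) blast+
    then show "x \<in> (\<lambda>w. THE x. x \<notin> S \<and> (w, x) \<in> R) ` neighbourhood G A"
      using w(1) by (intro rev_image_eqI[of w]) simp_all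
  qed
  have finT: "finite T"
    using sub fin_nbh by (meson finite_imageI finite_subset)
  have "card T \<le> s"
    using surj_card_le[OF fin_nbh sub] card_nbh by linarith
  then have card: "card (S \<union> T) \<le> card S + s"
    using card_Un_le[of S T] by linarith
  \<comment> \<open>A new monochromatic path from such an \<open>x\<close> cannot enter
    \<open>A\<close>: the vertex just before entry would lie in N(A) and in the old class of
    \<open>x\<close>, putting \<open>x\<close> into \<open>S\<close> or \<open>T\<close>. Off
    \<open>A\<close> colours are unchanged, so the path is an old one.\<close>
  have outside: "(x, y) \<in> R" if "(x, y) \<in> R'" "x \<notin> S \<union> T" "x \<notin> A" for x y
    using that(1) unfolding R'_def
  proof (induction rule: rtrancl_induct)
    case base
    then show ?case by (simp add: R_def)
  next
    case (step y z)
    have yA: "y \<notin> A"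
      using that(3) transR[OF _ symR[OF step.IH], of v] by (auto simp: A_def)
    have yz: "y \<rightarrow>\<^bsub>G\<^esub> z" "flood_move G \<omega> (v, d) y = flood_move G \<omega> (v, d) z"
      using step.hyps(2) by (auto simp: mono_arcs_def)
    have zA: "z \<notin> A"
    proof
      assume "z \<in> A"
      then have "y \<in> neighbourhood G A"
        using yz(1) yA by (auto simp: neighbourhood_def dest: graph_symmetric)
      then have "x \<in> S \<union> T"
        using symR[OF step.IH] by (auto simp: T_def)
      with that(2) show False by contradiction
    qed
    have "\<omega> y = \<omega> z"
      using yz(2) yA zA by (simp add: flood_move_eq_if[OF v] A_def R_def)
    then have "(y, z) \<in> R"
      using yz(1) by (auto simp: R_def mono_arcs_def)
    with step.IH show ?case by (rule transR)
  qed
  have "x = y" if xy: "(x, y) \<in> R'" "x \<notin> S \<union> T" "y \<notin> S \<union> T" for x y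
  proof -
    have yx: "(y, x) \<in> R'"
      using xy(1) sym_rtrancl_mono_arcs unfolding R'_def by (meson symD)
    have "(x, y) \<in> R"
    \<comment> \<open>Two vertices of \<open>A\<close> already share an old class; otherwise the
      path is followed from an endpoint outside \<open>A\<close>, reversed if that is
      \<open>y\<close>.\<close>
    proof (cases "x \<in> A \<and> y \<in> A")
      case True
      then have "(v, x) \<in> R" "(v, y) \<in> R" by (auto simp: A_def)
      then show ?thesis using transR[OF symR] by blast
    next
      case False
      then show ?thesis
        using outside[of x y] outside[of y x] xy yx symR[of y x] by blast
    qed
    then show ?thesis using S xy(2,3) by blast
  qed
  then have "discarding G (flood_move G \<omega> (v, d)) (S \<union> T)"
    using finS finT unfolding discarding_def R'_def by blast
  with card show ?thesis by blast
qed

lemma foldl_flood_move_discarding: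
  assumes nbh: "\<And>A. A \<subseteq> verts G \<Longrightarrow> Digraph_Component.connected (G \<restriction> A) \<Longrightarrow>
           card (neighbourhood G A) \<le> s"
    and "proper_colouring G \<omega>"
    and "set ms \<subseteq> verts G \<times> C"
  shows "\<exists>S. discarding G (foldl (flood_move G) \<omega> ms) S \<and> card S \<le> s * length ms"
  using assms(3)
proof (induction ms rule: rev_induct)
  case Nil
  \<comment> \<open>Properness makes all initial classes singletons, so nothing is discarded before
    the first move.\<close>
  have "mono_arcs G \<omega> = {}"
    using assms(2) by (auto simp: proper_colouring_def mono_arcs_def dest: adj_in_verts)
  then show ?case by (intro exI[of _ "{}"]) (auto simp: discarding_def)
next
  case (snoc m ms)
  obtain v d where m: "m = (v, d)" "v \<in> verts G"
    using snoc.prems by (cases m) auto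
  obtain S where S: "discarding G (foldl (flood_move G) \<omega> ms) S" "card S \<le> s * length ms"
    using snoc by auto
  have "\<exists>S'. discarding G (flood_move G (foldl (flood_move G) \<omega> ms) (v, d)) S' \<and>
      card S' \<le> card S + s"
    using nbh m(2) S(1) by (rule flood_move_discarding)
  then obtain S' where S': "discarding G (foldl (flood_move G) \<omega> (ms @ [m])) S'"
    "card S' \<le> card S + s"
    using m(1) by auto
  have "card S' \<le> s * length (ms @ [m])"
    using S(2) S'(2) by simp
  with S'(1) show ?case by blast
qed

text \<open>After flooding, the connected graph is a single class, so at most one vertex escapes
  \<open>S\<close>; it accounts for the summand 1.\<close>

lemma floods_to_length:
  assumes nbh: "\<And>A. A \<subseteq> verts G \<Longrightarrow> Digraph_Component.connected (G \<restriction> A) \<Longrightarrow>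
           card (neighbourhood G A) \<le> s"
    and "Digraph_Component.connected G"
    and "proper_colouring G \<omega>"
    and "floods_to G C \<omega> d ms"
  shows "card (verts G) \<le> s * length ms + 1"
proof -
  let ?\<omega> = "foldl (flood_move G) \<omega> ms"
  obtain S where S: "discarding G ?\<omega> S" "card S \<le> s * length ms"
    using foldl_flood_move_discarding[OF nbh assms(3), of ms C] assms(4)
    unfolding floods_to_def by auto
  have "G \<restriction> verts G = G"
    by (intro pre_digraph.equality) (auto simp: induce_subgraph_def)
  then have "mono_connected G ?\<omega> (verts G)"
    using assms(2,4) by (auto simp: mono_connected_def floods_to_def)
  then have "\<forall>x \<in> verts G - S. \<forall>y \<in> verts G - S. x = y"
    using mono_connected_imp_rtrancl S(1) unfolding discarding_def by blast
  then have "card (verts G - S) \<le> 1"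
    by (simp add: card_le_Suc0_iff_eq)
  moreover have "card (verts G) \<le> card (verts G - S) + card S"
    using diff_card_le_card_Diff[of S "verts G"] S(1)
    unfolding discarding_def by linarith
  ultimately show ?thesis using S(2) by linarith
qed

end

theorem proposition2p4:
  fixes G :: "('a, 'b) pre_digraph" and C :: "'c set" and \<omega> :: "'a \<Rightarrow> 'c" and n s :: nat
  assumes "graph G"
    and "Digraph_Component.connected G"
    and "card (verts G) = n" and "n \<ge> 1"
    and "finite C" and "\<omega> ` verts G \<subseteq> C"
    and "proper_colouring G \<omega>"
    and "s > 0"
    and "\<And>A. A \<subseteq> verts G \<Longrightarrow> Digraph_Component.connected (G \<restriction> A) \<Longrightarrow>
           card (neighbourhood G A) \<le> s"
  shows "real (min_moves G C \<omega>) \<ge> 1 / real s * (real n - 1)"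
proof -
  interpret graph G by fact
  \<comment> \<open>A vertex exists and its colour lies in \<open>C\<close>, so \<open>Min\<close>
    ranges over a nonempty finite set and is attained.\<close>
  have "verts G \<noteq> {}"
    using assms(3,4) by auto
  then have "C \<noteq> {}"
    using assms(6) by blast
  then have "min_moves G C \<omega> \<in> min_moves_to G C \<omega> ` C"
    unfolding min_moves_def using assms(5) by (intro Min_in) auto
  then obtain d where d: "d \<in> C" "min_moves G C \<omega> = min_moves_to G C \<omega> d"
    by blast
  obtain ms where ms: "floods_to G C \<omega> d ms" "length ms = min_moves G C \<omega>"
    using min_moves_to_attained[OF assms(1) d(1)] d(2) by metis
  \<comment> \<open>Stated additively, this avoids truncated subtraction on naturals before passing
    to the reals.\<close>
  have "n \<le> s * min_moves G C \<omega> + 1"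
    using floods_to_length[OF assms(9,2,7) ms(1)] assms(3) ms(2) by simp
  then have "real n \<le> real s * real (min_moves G C \<omega>) + 1"
    by (metis of_nat_1 of_nat_add of_nat_le_iff of_nat_mult)
  then show ?thesis
    using assms(8) by (simp add: field_simps)
qed

end
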